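(* For the Petersen graph $P$ (on $n=10$ vertices), $\min_{1 \leq k \leq n}\{k + \operatorname{rad}_k(P)\}=3$, $\operatorname{th}_c(P)=4$, and $\operatorname{th}_d(P) = 3$.
   Context: Cops and Robbers on a finite simple graph with $n$ vertices: in round $0$ each of $k$ cops and then the robber choose a vertex; in each later round each cop stays or moves along an edge, then the robber does the same; capture occurs when a cop occupies the robber's vertex. $\operatorname{capt}_k(G)$ is the minimum number of rounds for $k$ cops to capture a robber who evades as long as possible ($\infty$ if $k$ is less than the cop number). A vertex is damaged if the robber occupies it in a round in which capture does not occur; $\operatorname{dmg}_k(G)$ is the minimum number of damaged vertices over games with $k$ cops when the robber maximizes damage. $\operatorname{th}_c(G)=\min_{1\le k\le n}\{k+\operatorname{capt}_k(G)\}$, $\operatorname{th}_d(G)=\min_{1\le k\le n}\{k+\operatorname{dmg}_k(G)\}$. The $k$-radius is $\operatorname{rad}_k(G)=\min_{|S|=k}\max_{x\in V(G)}\min_{u\in S}d(u,x)$. *)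

theory Defs
  imports "HOL-Library.Extended_Nat"
begin

locale simple_graph =
  fixes V :: "'a set" and E :: "'a rel"
  assumes finite_V: "finite V" and V_nonempty: "V \<noteq> {}"
    and E_subset: "E \<subseteq> V \<times> V" and sym_E: "sym E" and irrefl_E: "irrefl E"
begin

text \<open>Length of a shortest walk, \<open>\<infinity>\<close> if there is none.\<close>

definition gdist :: "'a \<Rightarrow> 'a \<Rightarrow> enat" where
  "gdist u v = (INF l\<in>{l. (u, v) \<in> E ^^ l}. enat l)"

definition rad :: "nat \<Rightarrow> enat" where
  "rad k = (MIN S\<in>{S. S \<subseteq> V \<and> card S = k}. MAX x\<in>V. MIN u\<in>S. gdist u x)"

definition step :: "'a \<Rightarrow> 'a \<Rightarrow> bool" where
  "step u v \<longleftrightarrow> u = v \<or> (u, v) \<in> E"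

text \<open>
  \<open>r t\<close> is the position of the robber at the end of round \<open>t\<close>. Trajectories are infinite; whatever
  they do after the first capture has no influence on the capture time or the damage.
\<close>

definition robber_trajectory :: "(nat \<Rightarrow> 'a) \<Rightarrow> bool" where
  "robber_trajectory r \<longleftrightarrow> r 0 \<in> V \<and> (\<forall>t. step (r t) (r (Suc t)))"

text \<open>
  A cop strategy maps the list of the robber's positions so far to the list of the cops' positions
  (the cops' own previous positions are determined by the strategy and the robber's positions).
  As the cops move first in every round, their positions in round \<open>t\<close> depend on
  \<open>r 0, \<dots>, r (t - 1)\<close>. Several cops may share a vertex.
\<close>

definition cops :: "('a list \<Rightarrow> 'a list) \<Rightarrow> (nat \<Rightarrow> 'a) \<Rightarrow> nat \<Rightarrow> 'a list" where
  "cops \<sigma> r t = \<sigma> (map r [0..<t])"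

definition cop_strategy :: "nat \<Rightarrow> ('a list \<Rightarrow> 'a list) \<Rightarrow> bool" where
  "cop_strategy k \<sigma> \<longleftrightarrow> length (\<sigma> []) = k \<and> set (\<sigma> []) \<subseteq> V \<and>
     (\<forall>r. robber_trajectory r \<longrightarrow> (\<forall>t. list_all2 step (cops \<sigma> r t) (cops \<sigma> r (Suc t))))"

text \<open>In a round \<open>t > 0\<close> the robber can be caught by the move of the cops or by his own move.\<close>

definition capture_in :: "(nat \<Rightarrow> 'a list) \<Rightarrow> (nat \<Rightarrow> 'a) \<Rightarrow> nat \<Rightarrow> bool" where
  "capture_in c r t \<longleftrightarrow> r t \<in> set (c t) \<or> (t > 0 \<and> r (t - 1) \<in> set (c t))"

definition capture_time :: "(nat \<Rightarrow> 'a list) \<Rightarrow> (nat \<Rightarrow> 'a) \<Rightarrow> enat" where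
  "capture_time c r = (INF t\<in>{t. capture_in c r t}. enat t)"

text \<open>
  The usual convention for damage: the vertex on which the robber stands when round \<open>t + 1\<close> begins
  is damaged if that round passes without capture. So a vertex on which the robber is caught by the
  very next move of the cops, in particular a start vertex adjacent to a cop, is not damaged.
\<close>

definition damaged :: "(nat \<Rightarrow> 'a list) \<Rightarrow> (nat \<Rightarrow> 'a) \<Rightarrow> 'a set" where
  "damaged c r = {r t |t. \<forall>s\<le>Suc t. \<not> capture_in c r s}"

definition capt :: "nat \<Rightarrow> enat" where
  "capt k = (INF \<sigma>\<in>{\<sigma>. cop_strategy k \<sigma>}. SUP r\<in>{r. robber_trajectory r}.
     capture_time (cops \<sigma> r) r)"

definition dmg :: "nat \<Rightarrow> enat" where
  "dmg k = (INF \<sigma>\<in>{\<sigma>. cop_strategy k \<sigma>}. SUP r\<in>{r. robber_trajectory r}.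
     enat (card (damaged (cops \<sigma> r) r)))"

definition th_c :: enat where
  "th_c = (MIN k\<in>{1..card V}. enat k + capt k)"

definition th_d :: enat where
  "th_d = (MIN k\<in>{1..card V}. enat k + dmg k)"

end

text \<open>The Petersen graph as the Kneser graph of the 2-subsets of a 5-element set.\<close>

definition petersen_verts :: "nat set set" where
  "petersen_verts = {A. A \<subseteq> {0..<5} \<and> card A = 2}"

definition petersen_edges :: "nat set rel" where
  "petersen_edges = {(A, B). A \<in> petersen_verts \<and> B \<in> petersen_verts \<and> A \<inter> B = {}}"

lemma card_petersen_verts: "card petersen_verts = 10"
  using n_subsets[of "{0..<5::nat}" 2] by (simp add: petersen_verts_def choose_two)

interpretation petersen: simple_graph petersen_verts petersen_edges
proof
  show "finite petersen_verts" and "petersen_verts \<noteq> {}"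
    using card_petersen_verts by (auto intro: card_ge_0_finite)
qed (auto simp: petersen_edges_def petersen_verts_def sym_def irrefl_def)

end

theory Submission
  imports Defs
begin

text \<open>
  Three vertices dominate the Petersen graph, so three cops win in round 1 without any damage, and
  one vertex has eccentricity 2; this gives the upper bounds. Two closed neighbourhoods cover at most
  8 of the 10 vertices, so against two cops the robber survives round 1 and damages his start
  vertex. Against one cop, every vertex \<open>v\<close> other than the cop's position \<open>c\<close> has a neighbour
  outside the closed neighbourhood of \<open>c\<close>, so the robber can survive round 2 while damaging two
  vertices.
\<close>

context simple_graph
begin

section \<open>Distances and the k-radius in a finite simple graph\<close>

lemma step_refl [simp]: "step u u"
  by (simp add: step_def)

lemma step_in_V: "step u v \<Longrightarrow> u \<in> V \<Longrightarrow> v \<in> V"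
  using E_subset by (auto simp: step_def)

lemma gdist_le: "(u, v) \<in> E ^^ l \<Longrightarrow> gdist u v \<le> enat l"
  unfolding gdist_def by (rule INF_lower) simp

lemma one_le_gdist:
  assumes "u \<noteq> v"
  shows "1 \<le> gdist u v"
  unfolding gdist_def
proof (rule INF_greatest)
  fix l assume "l \<in> {l. (u, v) \<in> E ^^ l}"
  with assms have "l \<noteq> 0" by (cases l) auto
  then show "1 \<le> enat l" by (simp add: one_enat_def)
qed

lemma two_le_gdist:
  assumes "\<not> step u v"
  shows "2 \<le> gdist u v"
  unfolding gdist_def
proof (rule INF_greatest)
  fix l assume "l \<in> {l. (u, v) \<in> E ^^ l}"
  with assms have "l \<noteq> 0" "l \<noteq> 1" by (auto simp: step_def intro!: gr0I)
  then have "2 \<le> l" by linarith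
  then show "2 \<le> enat l" by (simp add: numeral_eq_enat)
qed

lemma finite_subsets_card: "finite {S. S \<subseteq> V \<and> card S = k}"
  by (rule finite_subset[of _ "Pow V"]) (auto simp: finite_V)

lemma rad_le:
  assumes "S \<subseteq> V" "card S = k" and "\<And>x. x \<in> V \<Longrightarrow> \<exists>u\<in>S. gdist u x \<le> d"
  shows "rad k \<le> d"
proof -
  have "finite S" using assms(1) finite_V finite_subset by blast
  have "rad k \<le> (MAX x\<in>V. MIN u\<in>S. gdist u x)"
    unfolding rad_def using assms(1,2) by (intro Min_le) (auto simp: finite_subsets_card)
  also have "\<dots> \<le> d"
  proof (rule Max.boundedI)
    fix a assume "a \<in> (\<lambda>x. MIN u\<in>S. gdist u x) ` V"
    then obtain x where x: "x \<in> V" and a: "a = (MIN u\<in>S. gdist u x)" by blast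
    from assms(3)[OF x] obtain u where "u \<in> S" "gdist u x \<le> d" by blast
    then show "a \<le> d"
      unfolding a using \<open>finite S\<close> by (meson Min_le finite_imageI imageI order_trans)
  qed (simp_all add: finite_V V_nonempty)
  finally show ?thesis .
qed

text \<open>The bounds on \<open>k\<close> keep both minima off the empty set, where
  \<open>Min\<close> is unspecified: \<open>1 \<le> k\<close> makes every \<open>S\<close> nonempty,
  and \<open>k \<le> card V\<close> provides at least one \<open>S\<close>.\<close>

lemma le_rad:
  assumes "1 \<le> k" "k \<le> card V"
    and "\<And>S. S \<subseteq> V \<Longrightarrow> card S = k \<Longrightarrow> \<exists>x\<in>V. \<forall>u\<in>S. d \<le> gdist u x"
  shows "d \<le> rad k"
  unfolding rad_def
proof (rule Min.boundedI)
  fix a assume "a \<in> (\<lambda>S. MAX x\<in>V. MIN u\<in>S. gdist u x) ` {S. S \<subseteq> V \<and> card S = k}"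
  then obtain S where S: "S \<subseteq> V" "card S = k" and a: "a = (MAX x\<in>V. MIN u\<in>S. gdist u x)"
    by blast
  have "finite S" "S \<noteq> {}"
    using S assms(1) finite_V finite_subset by auto
  from assms(3)[OF S] obtain x where x: "x \<in> V" "\<forall>u\<in>S. d \<le> gdist u x" by blast
  then have "d \<le> (MIN u\<in>S. gdist u x)"
    using \<open>finite S\<close> \<open>S \<noteq> {}\<close> by simp
  also have "\<dots> \<le> a"
    unfolding a using x(1) finite_V by (intro Max_ge) auto
  finally show "d \<le> a" .
next
  obtain S where "S \<subseteq> V" "card S = k"
    using assms(2) by (metis obtain_subset_with_card_n)
  then show "(\<lambda>S. MAX x\<in>V. MIN u\<in>S. gdist u x) ` {S. S \<subseteq> V \<and> card S = k} \<noteq> {}"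
    by blast
qed (simp add: finite_subsets_card)

section \<open>Bounds on capture time and damage from strategies and evasions\<close>

lemma robber_trajectory_in_V: "robber_trajectory r \<Longrightarrow> r t \<in> V"
  by (induction t) (auto simp: robber_trajectory_def intro: step_in_V)

lemma robber_trajectory_const: "v \<in> V \<Longrightarrow> robber_trajectory (\<lambda>_. v)"
  by (simp add: robber_trajectory_def)

lemma finite_damaged: "robber_trajectory r \<Longrightarrow> finite (damaged c r)"
  by (rule finite_subset[OF _ finite_V]) (auto simp: damaged_def robber_trajectory_in_V)

lemma cops_step:
  "cop_strategy k \<sigma> \<Longrightarrow> robber_trajectory r \<Longrightarrow> list_all2 step (cops \<sigma> r t) (cops \<sigma> r (Suc t))"
  by (simp add: cop_strategy_def)

lemma cops_step_from:
  assumes "cop_strategy k \<sigma>" "robber_trajectory r" "x \<in> set (cops \<sigma> r (Suc t))"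
  obtains u where "u \<in> set (cops \<sigma> r t)" "step u x"
  using cops_step[OF assms(1,2), of t] assms(3)
  by (metis in_set_conv_nth list_all2_conv_all_nth)

lemma cops_0: "cops \<sigma> r 0 = \<sigma> []"
  by (simp add: cops_def)

lemma le_capt:
  assumes "\<And>\<sigma>. cop_strategy k \<sigma> \<Longrightarrow>
    \<exists>r. robber_trajectory r \<and> (\<forall>s<m. \<not> capture_in (cops \<sigma> r) r s)"
  shows "enat m \<le> capt k"
  unfolding capt_def
proof (rule INF_greatest)
  fix \<sigma> assume "\<sigma> \<in> {\<sigma>. cop_strategy k \<sigma>}"
  then obtain r where r: "robber_trajectory r" "\<forall>s<m. \<not> capture_in (cops \<sigma> r) r s"
    using assms by blast
  have "enat m \<le> capture_time (cops \<sigma> r) r"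
    unfolding capture_time_def
    by (rule INF_greatest) (use r(2) in \<open>auto simp: not_less[symmetric]\<close>)
  also have "\<dots> \<le> (SUP r\<in>{r. robber_trajectory r}. capture_time (cops \<sigma> r) r)"
    by (rule SUP_upper) (simp add: r)
  finally show "enat m \<le> \<dots>" .
qed

text \<open>The range \<open>s \<le> m\<close> is one round longer than in \<open>le_capt\<close>:
  \<open>r t\<close> counts as damaged only if round \<open>t + 1\<close> also passes without
  capture, so damaging \<open>r 0, ..., r (m - 1)\<close> takes survival through round
  \<open>m\<close>.\<close>

lemma le_dmg:
  assumes "\<And>\<sigma>. cop_strategy k \<sigma> \<Longrightarrow>
    \<exists>r. robber_trajectory r \<and> (\<forall>s\<le>m. \<not> capture_in (cops \<sigma> r) r s) \<and> inj_on r {..<m}"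
  shows "enat m \<le> dmg k"
  unfolding dmg_def
proof (rule INF_greatest)
  fix \<sigma> assume "\<sigma> \<in> {\<sigma>. cop_strategy k \<sigma>}"
  then obtain r where r: "robber_trajectory r" "\<forall>s\<le>m. \<not> capture_in (cops \<sigma> r) r s"
    and inj: "inj_on r {..<m}"
    using assms by blast
  have "r ` {..<m} \<subseteq> damaged (cops \<sigma> r) r"
    using r(2) by (fastforce simp: damaged_def)
  then have "m \<le> card (damaged (cops \<sigma> r) r)"
    using card_mono[OF finite_damaged[OF r(1)]] card_image[OF inj] by (metis card_lessThan)
  then have "enat m \<le> enat (card (damaged (cops \<sigma> r) r))" by simp
  also have "\<dots> \<le> (SUP r\<in>{r. robber_trajectory r}. enat (card (damaged (cops \<sigma> r) r)))"
    by (rule SUP_upper) (simp add: r)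
  finally show "enat m \<le> \<dots>" .
qed

text \<open>Wherever the robber starts, some cop stands on or next to that vertex and occupies it in
  round 1. As damage requires surviving round 1, not even the start vertex is damaged.\<close>

lemma dominating_cops:
  assumes "length C = k" "set C \<subseteq> V" and dom: "\<And>v. v \<in> V \<Longrightarrow> \<exists>u\<in>set C. step u v"
  shows "capt k \<le> 1" "dmg k = 0"
proof -
  \<comment> \<open>Every cop within reach of the robber's start \<open>x\<close> moves there, and
    nobody moves afterwards. Only the first robber position is read, so the cops are constant from
    round 1 on.\<close>
  define \<sigma> where "\<sigma> xs = (case xs of [] \<Rightarrow> C | x # _ \<Rightarrow> map (\<lambda>u. if step u x then x else u) C)"
    for xs
  have \<sigma>_Suc: "cops \<sigma> r (Suc t) = map (\<lambda>u. if step u (r 0) then r 0 else u) C" for r t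
    by (simp add: cops_def \<sigma>_def upt_conv_Cons del: upt_Suc)
  have "list_all2 step (cops \<sigma> r t) (cops \<sigma> r (Suc t))" for r t
    by (cases t) (auto simp: \<sigma>_Suc cops_0 \<sigma>_def list_all2_conv_all_nth)
  then have strat: "cop_strategy k \<sigma>"
    using assms(1,2) by (simp add: cop_strategy_def \<sigma>_def)
  have capture: "capture_in (cops \<sigma> r) r 1" if "robber_trajectory r" for r
  proof -
    from dom[OF robber_trajectory_in_V[OF that]] obtain u where "u \<in> set C" "step u (r 0)" by blast
    then have "r 0 \<in> set (cops \<sigma> r 1)"
      by (force simp: \<sigma>_Suc[of _ 0, simplified])
    then show ?thesis by (simp add: capture_in_def)
  qed
  have "capt k \<le> (SUP r\<in>{r. robber_trajectory r}. capture_time (cops \<sigma> r) r)"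
    unfolding capt_def by (rule INF_lower) (simp add: strat)
  also have "\<dots> \<le> 1"
    unfolding capture_time_def using capture
    by (intro SUP_least INF_lower2[of 1]) (auto simp: one_enat_def)
  finally show "capt k \<le> 1" .
  have "dmg k \<le> (SUP r\<in>{r. robber_trajectory r}. enat (card (damaged (cops \<sigma> r) r)))"
    unfolding dmg_def by (rule INF_lower) (simp add: strat)
  also have "\<dots> \<le> 0"
  proof (rule SUP_least)
    fix r assume "r \<in> {r. robber_trajectory r}"
    then have "damaged (cops \<sigma> r) r = {}"
      using capture[of r] by (auto simp: damaged_def)
    then show "enat (card (damaged (cops \<sigma> r) r)) \<le> 0" by (simp add: zero_enat_def)
  qed
  finally show "dmg k = 0" by simp
qed

text \<open>Fewer cops than vertices leave a free vertex to start on, which rules out capture in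
  round 0.\<close>

lemma one_le_capt:
  assumes "k < card V"
  shows "1 \<le> capt k"
proof -
  have "enat 1 \<le> capt k"
  proof (rule le_capt)
    fix \<sigma> assume "cop_strategy k \<sigma>"
    then have "card (set (\<sigma> [])) < card V"
      using assms card_length[of "\<sigma> []"] by (simp add: cop_strategy_def)
    then obtain v where "v \<in> V" "v \<notin> set (\<sigma> [])"
      by (metis List.finite_set card_mono linorder_not_le subsetI)
    then show "\<exists>r. robber_trajectory r \<and> (\<forall>s<1. \<not> capture_in (cops \<sigma> r) r s)"
      by (intro exI[of _ "\<lambda>_. v"])
        (auto simp: robber_trajectory_const capture_in_def cops_0)
  qed
  then show ?thesis by (simp add: one_enat_def)
qed

text \<open>The robber starts on a vertex outside all closed neighbourhoods of the cops and never
  moves. After one move the cops are still inside those neighbourhoods, so rounds 0 and 1 pass and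
  the start vertex is damaged.\<close>

lemma non_dominating_cops:
  assumes "\<And>C. length C = k \<Longrightarrow> set C \<subseteq> V \<Longrightarrow> \<exists>v\<in>V. \<forall>u\<in>set C. \<not> step u v"
  shows "2 \<le> capt k" "1 \<le> dmg k"
proof -
  have *: "\<exists>r. robber_trajectory r \<and> (\<forall>s\<le>1. \<not> capture_in (cops \<sigma> r) r s)"
    if \<sigma>: "cop_strategy k \<sigma>" for \<sigma>
  proof -
    from assms \<sigma> obtain v where v: "v \<in> V" "\<And>u. u \<in> set (\<sigma> []) \<Longrightarrow> \<not> step u v"
      unfolding cop_strategy_def by blast
    note traj = robber_trajectory_const[OF v(1)]
    have "v \<notin> set (cops \<sigma> (\<lambda>_. v) 0)"
      using v(2) step_refl unfolding cops_0 by blast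
    moreover have "v \<notin> set (cops \<sigma> (\<lambda>_. v) (Suc 0))"
      using v(2) cops_step_from[OF \<sigma> traj, of v 0] by (auto simp: cops_0)
    ultimately show ?thesis
      using traj by (intro exI[of _ "\<lambda>_. v"]) (auto simp: capture_in_def le_Suc_eq)
  qed
  have "enat 2 \<le> capt k"
    by (rule le_capt) (use * in \<open>auto simp: less_Suc_eq_le numeral_2_eq_2\<close>)
  then show "2 \<le> capt k" by (simp add: numeral_eq_enat)
  have "enat 1 \<le> dmg k"
    by (rule le_dmg) (use * in \<open>auto simp: inj_on_def\<close>)
  then show "1 \<le> dmg k" by (simp add: one_enat_def)
qed

text \<open>The robber starts out of the cop's reach, sees the cop's first move, and then flees to a
  neighbour out of reach of the new position. Rounds 0, 1 and 2 pass, and both robber positions are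
  damaged.\<close>

lemma one_cop_evasion:
  assumes start: "\<And>c. c \<in> V \<Longrightarrow> \<exists>v\<in>V. \<not> step c v"
    and flee: "\<And>c v. c \<in> V \<Longrightarrow> v \<in> V \<Longrightarrow> c \<noteq> v \<Longrightarrow> \<exists>w. (v, w) \<in> E \<and> \<not> step c w"
  shows "3 \<le> capt 1" "2 \<le> dmg 1"
proof -
  have *: "\<exists>r. robber_trajectory r \<and> (\<forall>s\<le>2. \<not> capture_in (cops \<sigma> r) r s) \<and> inj_on r {..<2}"
    if \<sigma>: "cop_strategy 1 \<sigma>" for \<sigma>
  proof -
    obtain c0 where c0: "\<sigma> [] = [c0]" "c0 \<in> V"
      using \<sigma> by (auto simp: cop_strategy_def length_Suc_conv)
    from start[OF c0(2)] obtain v where v: "v \<in> V" "\<not> step c0 v" by blast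
    \<comment> \<open>The cop's position in round 1 depends only on the start \<open>v\<close>, so
      it can be read off from the constant trajectory before the flight vertex is chosen.\<close>
    have "list_all2 step [c0] (\<sigma> [v])"
      using cops_step[OF \<sigma> robber_trajectory_const[OF v(1)], of 0] c0 by (simp add: cops_def)
    then obtain c1 where c1: "\<sigma> [v] = [c1]" "step c0 c1"
      by (auto simp: list_all2_Cons1)
    \<comment> \<open>The cop could not reach \<open>v\<close> in one move, hence
      \<open>c1 \<noteq> v\<close> and \<open>flee\<close> applies.\<close>
    from flee[OF step_in_V[OF c1(2) c0(2)] v(1)] v(2) c1(2)
    obtain w where w: "(v, w) \<in> E" "\<not> step c1 w" by blast
    define r where "r t = (if t = 0 then v else w)" for t :: nat
    have traj: "robber_trajectory r"
      using v(1) w(1) by (auto simp: robber_trajectory_def r_def step_def)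
    have cops1: "cops \<sigma> r 1 = [c1]"
      using c1 by (simp add: cops_def r_def)
    have "\<not> capture_in (cops \<sigma> r) r 0"
      using v(2) c0 by (auto simp: capture_in_def cops_0 r_def)
    moreover have "\<not> capture_in (cops \<sigma> r) r 1"
      using v(2) c1(2) w(2) cops1 by (auto simp: capture_in_def r_def)
    moreover have "\<not> capture_in (cops \<sigma> r) r 2"
    \<comment> \<open>The robber stays on \<open>w\<close> in round 2, so both clauses of
      \<open>capture_in\<close> ask whether the cop is on \<open>w\<close>, which is out of reach of
      \<open>c1\<close>.\<close>
    proof -
      have "w \<notin> set (cops \<sigma> r (Suc 1))"
        using w(2) cops1 cops_step_from[OF \<sigma> traj, of w 1] by auto
      then show ?thesis by (simp add: capture_in_def r_def numeral_2_eq_2)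
    qed
    moreover have "v \<noteq> w"
      using w(1) irrefl_E by (auto simp: irrefl_def)
    then have "inj_on r {..<2}"
      by (auto simp: inj_on_def r_def)
    ultimately show ?thesis
      using traj by (intro exI[of _ r]) (auto simp: le_Suc_eq numeral_2_eq_2)
  qed
  have "enat 3 \<le> capt 1"
  proof (rule le_capt)
    fix \<sigma> assume "cop_strategy 1 \<sigma>"
    from *[OF this] show "\<exists>r. robber_trajectory r \<and> (\<forall>s<3. \<not> capture_in (cops \<sigma> r) r s)"
      by (auto simp: less_Suc_eq_le numeral_3_eq_3 numeral_2_eq_2)
  qed
  then show "3 \<le> capt 1" by (simp add: numeral_eq_enat)
  have "enat 2 \<le> dmg 1"
    by (rule le_dmg) (rule *)
  then show "2 \<le> dmg 1" by (simp add: numeral_eq_enat)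
qed

end

text \<open>Only the team sizes below \<open>m\<close> have to be examined, since for
  \<open>j \<ge> m\<close> the summand \<open>j\<close> alone already reaches
  \<open>m\<close>.\<close>

lemma Min_enat_add_eqI:
  fixes f :: "nat \<Rightarrow> enat"
  assumes "k \<in> {1..n}" "enat k + f k \<le> enat m"
    and "\<And>j. 1 \<le> j \<Longrightarrow> j < m \<Longrightarrow> j \<le> n \<Longrightarrow> enat m \<le> enat j + f j"
  shows "(MIN k\<in>{1..n}. enat k + f k) = enat m"
proof (rule antisym)
  show "(MIN k\<in>{1..n}. enat k + f k) \<le> enat m"
    using assms(1,2) by (meson Min_le finite_atLeastAtMost finite_imageI imageI order_trans)
  show "enat m \<le> (MIN k\<in>{1..n}. enat k + f k)"
  proof (rule Min.boundedI)
    fix a assume "a \<in> (\<lambda>k. enat k + f k) ` {1..n}"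
    then obtain j where j: "j \<in> {1..n}" "a = enat j + f j" by blast
    show "enat m \<le> a"
    proof (cases "j < m")
      case False
      then have "enat m \<le> enat j" by simp
      also have "\<dots> \<le> a" by (simp add: j)
      finally show ?thesis .
    qed (use j assms(3) in auto)
  qed (use assms(1) in auto)
qed

section \<open>Neighbourhoods, domination and distances in the Petersen graph\<close>

lemma petersen_vertsD:
  assumes "A \<in> petersen_verts"
  shows "A \<subseteq> {0..<5}" "card A = 2" "finite A"
  using assms by (auto simp: petersen_verts_def intro: finite_subset)

lemma petersen_step_iff:
  "petersen.step u v \<longleftrightarrow> u = v \<or> u \<in> petersen_verts \<and> v \<in> petersen_verts \<and> u \<inter> v = {}"
  unfolding petersen.step_def unfolding petersen_edges_def by simp

text \<open>Besides \<open>c\<close> itself there are the three 2-subsets of its 3-element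
  complement.\<close>

lemma card_petersen_closed_neighbourhood:
  assumes c: "c \<in> petersen_verts"
  shows "card {v. petersen.step c v} = 4"
proof -
  note c' = petersen_vertsD[OF c]
  let ?N = "{B. B \<subseteq> {0..<5} - c \<and> card B = 2}"
  have "petersen.step c v \<longleftrightarrow> v \<in> insert c ?N" for v
    using c unfolding petersen_step_iff by (auto simp: petersen_verts_def)
  then have eq: "{v. petersen.step c v} = insert c ?N" by blast
  have "c \<notin> ?N" using c'(2) by (auto simp: subset_iff)
  moreover have "card ({0..<5} - c) = 3"
    using c' by (simp add: card_Diff_subset)
  then have "card ?N = 3"
    using n_subsets[of "{0..<5} - c" 2] by (simp add: choose_two)
  moreover from this have "finite ?N" by (intro card_ge_0_finite) simp
  ultimately show ?thesis unfolding eq by simp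
qed

lemma petersen_two_not_dominating:
  assumes "C \<subseteq> petersen_verts" "card C \<le> 2"
  shows "\<exists>v\<in>petersen_verts. \<forall>u\<in>C. \<not> petersen.step u v"
proof (rule ccontr)
  assume "\<not> ?thesis"
  then have sub: "petersen_verts \<subseteq> (\<Union>u\<in>C. {v. petersen.step u v})" by blast
  have fin: "finite C"
    using assms(1) petersen.finite_V finite_subset by blast
  \<comment> \<open>Since \<open>card\<close> is 0 on infinite sets, a positive cardinality gives
    finiteness.\<close>
  have fN: "finite {v. petersen.step u v}" if "u \<in> C" for u
    using card_petersen_closed_neighbourhood[of u] that assms(1)
    by (intro card_ge_0_finite) auto
  have "10 \<le> card (\<Union>u\<in>C. {v. petersen.step u v})"
    using card_mono[OF _ sub] fin fN by (auto simp: card_petersen_verts)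
  also have "\<dots> \<le> (\<Sum>u\<in>C. card {v. petersen.step u v})"
    by (rule card_UN_le[OF fin])
  also have "\<dots> = 4 * card C"
    using card_petersen_closed_neighbourhood assms(1) by (simp add: subset_iff)
  finally show False using assms(2) by simp
qed

text \<open>Pick \<open>x\<close> in \<open>c\<close> but not in \<open>v\<close>, and let
  \<open>y\<close>, \<open>z\<close> be the other two elements outside \<open>v\<close>. Both
  \<open>{x, y}\<close> and \<open>{x, z}\<close> are neighbours of \<open>v\<close> and meet
  \<open>c\<close> in \<open>x\<close>, so neither is adjacent to \<open>c\<close>; at most one of
  them equals \<open>c\<close>, and the other is the escape.\<close>

lemma petersen_flee:
  assumes c: "c \<in> petersen_verts" and v: "v \<in> petersen_verts" and ne: "c \<noteq> v"
  shows "\<exists>w. (v, w) \<in> petersen_edges \<and> \<not> petersen.step c w"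
proof -
  note c' = petersen_vertsD[OF c] and v' = petersen_vertsD[OF v]
  have "\<not> c \<subseteq> v"
    using ne c' v' by (metis card_subset_eq)
  then obtain x where x: "x \<in> c" "x \<notin> v" by blast
  have "card ({0..<5} - v - {x}) = 2"
    using x c' v' by (simp add: card_Diff_subset subset_iff)
  then obtain y z where yz: "{0..<5} - v - {x} = {y, z}" "y \<noteq> z"
    by (auto simp: card_2_iff)
  then have mem: "y \<in> {0..<5}" "z \<in> {0..<5}" "y \<notin> v" "z \<notin> v" "y \<noteq> x" "z \<noteq> x"
    by blast+
  have "{x, y} \<noteq> {x, z}" using yz(2) by (auto simp: doubleton_eq_iff)
  then obtain w where w: "w \<in> {{x, y}, {x, z}}" "w \<noteq> c" by blast
  have "w \<in> petersen_verts" "v \<inter> w = {}" "c \<inter> w \<noteq> {}"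
    using w(1) mem x c'(1) by (auto simp: petersen_verts_def)
  then have "(v, w) \<in> petersen_edges" "\<not> petersen.step c w"
    using v w(2) by (simp_all only: petersen_step_iff) (auto simp: petersen_edges_def)
  then show ?thesis by blast
qed

text \<open>Two distinct pairs that intersect have a 3-element union, and the complement of that
  union is a common neighbour.\<close>

lemma petersen_gdist_le_2:
  assumes u: "u \<in> petersen_verts" and v: "v \<in> petersen_verts"
  shows "petersen.gdist u v \<le> 2"
proof -
  note u' = petersen_vertsD[OF u] and v' = petersen_vertsD[OF v]
  consider "u = v" | "u \<inter> v = {}" | "u \<noteq> v" "u \<inter> v \<noteq> {}" by blast
  then have "\<exists>l\<le>2. (u, v) \<in> petersen_edges ^^ l"
  proof cases
    case 1
    then have "(u, v) \<in> petersen_edges ^^ 0" by simp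
    then show ?thesis by blast
  next
    case 2
    then have "(u, v) \<in> petersen_edges ^^ 1"
      using u v by (simp add: petersen_edges_def)
    then show ?thesis by (intro exI[of _ 1]) simp
  next
    case 3
    have "\<not> u \<subseteq> v" using 3 u' v' by (metis card_subset_eq)
    then have "u \<inter> v \<subset> u" by blast
    then have "card (u \<inter> v) < 2"
      using psubset_card_mono[OF u'(3)] u'(2) by metis
    moreover have "card (u \<inter> v) \<noteq> 0" using 3 u'(3) by simp
    ultimately have "card (u \<union> v) = 3"
      using card_Un_Int[OF u'(3) v'(3)] u' v' by linarith
    then have "card ({0..<5} - (u \<union> v)) = 2"
      using u' v' by (subst card_Diff_subset) auto
    then have "(u, {0..<5} - (u \<union> v)) \<in> petersen_edges" "({0..<5} - (u \<union> v), v) \<in> petersen_edges"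
      using u v by (auto simp: petersen_edges_def petersen_verts_def)
    then have "(u, v) \<in> petersen_edges ^^ 2"
      by (auto simp: numeral_2_eq_2)
    then show ?thesis by blast
  qed
  then obtain l where "l \<le> 2" "(u, v) \<in> petersen_edges ^^ l" by blast
  then show ?thesis
    using petersen.gdist_le[of u v l] by (simp add: numeral_eq_enat order_trans)
qed

text \<open>A pair disjoint from none of the three sides of the triangle on 0, 1, 2 contains at
  least two of these points and is therefore itself a side.\<close>

lemma petersen_three_dominating:
  assumes v: "v \<in> petersen_verts"
  shows "\<exists>u\<in>set [{0, 1}, {0, 2}, {1, 2}]. petersen.step u v"
proof (rule ccontr)
  assume contra: "\<not> ?thesis"
  note v' = petersen_vertsD[OF v]
  have *: "u \<inter> v \<noteq> {} \<and> \<not> u \<subseteq> v" if u: "u \<in> {{0, 1}, {0, 2}, {1, 2}}" for u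
  proof -
    have "u \<in> petersen_verts"
      using u by (auto simp: petersen_verts_def)
    moreover have "\<not> petersen.step u v"
      using contra u unfolding list.set by blast
    ultimately show ?thesis
      using v v' petersen_vertsD[of u] card_subset_eq[of v u]
      by (simp add: petersen_step_iff) blast
  qed
  show False
    \<comment> \<open>An undominated \<open>v\<close> would contain exactly one point of each side;
      but among 0, 1, 2 some two points are both in \<open>v\<close> or both outside it.\<close>
    using *[of "{0, 1}"] *[of "{0, 2}"] *[of "{1, 2}"] by simp blast
qed

section \<open>Evaluation of the three minima\<close>

theorem theorem2p17:
  shows "(MIN k\<in>{1..card petersen_verts}. enat k + petersen.rad k) = 3
    \<and> petersen.th_c = 4 \<and> petersen.th_d = 3"
proof (intro conjI)
  let ?P = petersen_verts
  have k12: "j = 1 \<or> j = 2" if "1 \<le> j" "j < 3" for j :: nat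
    using that by linarith
  have two_cops: "2 \<le> petersen.capt 2" "1 \<le> petersen.dmg 2"
  proof -
    have not_dom: "\<exists>v\<in>?P. \<forall>u\<in>set C. \<not> petersen.step u v" if "length C = 2" "set C \<subseteq> ?P" for C
      \<comment> \<open>Two cops may share a vertex, so their positions form a set of at most two
        elements.\<close>
      using petersen_two_not_dominating[of "set C"] card_length[of C] that by simp
    show "2 \<le> petersen.capt 2" "1 \<le> petersen.dmg 2"
      by (rule petersen.non_dominating_cops; erule (1) not_dom)+
  qed
  have one_cop: "3 \<le> petersen.capt 1" "2 \<le> petersen.dmg 1"
  proof -
    have start: "\<exists>v\<in>?P. \<not> petersen.step c v" if "c \<in> ?P" for c
      using petersen_two_not_dominating[of "{c}"] that by simp
    show "3 \<le> petersen.capt 1" "2 \<le> petersen.dmg 1"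
      by (rule petersen.one_cop_evasion; (erule start | erule (2) petersen_flee))+
  qed
  have three_cops: "petersen.capt 3 \<le> 1" "petersen.dmg 3 = 0"
  proof -
    have len: "length [{0, 1}, {0, 2}, {1, 2 :: nat}] = 3"
      and sub: "set [{0, 1}, {0, 2}, {1, 2}] \<subseteq> ?P"
      by (auto simp: petersen_verts_def)
    show "petersen.capt 3 \<le> 1" "petersen.dmg 3 = 0"
      by (rule petersen.dominating_cops[OF len sub], erule petersen_three_dominating)+
  qed

  have rad_1: "2 \<le> petersen.rad 1"
  proof (rule petersen.le_rad)
    fix S assume "S \<subseteq> ?P" "card S = 1"
    then show "\<exists>x\<in>?P. \<forall>u\<in>S. 2 \<le> petersen.gdist u x"
      \<comment> \<open>A vertex outside the closed neighbourhood of the centre has distance at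
        least 2 from it.\<close>
      using petersen_two_not_dominating[of S] petersen.two_le_gdist by fastforce
  qed (simp_all add: card_petersen_verts)
  have rad_2: "1 \<le> petersen.rad 2"
  proof (rule petersen.le_rad)
    fix S assume S: "S \<subseteq> ?P" "card S = 2"
    then obtain x where "x \<in> ?P" "x \<notin> S"
      using petersen_two_not_dominating[of S] petersen.step_refl by fastforce
    then show "\<exists>x\<in>?P. \<forall>u\<in>S. 1 \<le> petersen.gdist u x"
      using petersen.one_le_gdist by metis
  qed (simp_all add: card_petersen_verts)
  have rad_1_le: "petersen.rad 1 \<le> 2"
  proof (rule petersen.rad_le)
    show "{{0, 1}} \<subseteq> ?P" by (auto simp: petersen_verts_def)
    then show "\<exists>u\<in>{{0, 1}}. petersen.gdist u x \<le> 2" if "x \<in> ?P" for x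
      using that petersen_gdist_le_2 by blast
  qed simp

  have "(MIN k\<in>{1..card ?P}. enat k + petersen.rad k) = enat 3"
  proof (rule Min_enat_add_eqI[of 1])
    \<comment> \<open>The radius minimum is attained by a single centre: 1 + 2.\<close>
    show "enat 1 + petersen.rad 1 \<le> enat 3"
      using add_left_mono[OF rad_1_le, of "enat 1"] by (simp add: numeral_eq_enat eval_nat_numeral)
    show "enat 3 \<le> enat j + petersen.rad j" if "1 \<le> j" "j < 3" for j
      using k12[OF that] add_left_mono[OF rad_1, of "enat 1"] add_left_mono[OF rad_2, of "enat 2"]
      by (auto simp: numeral_eq_enat one_enat_def eval_nat_numeral)
  qed (simp add: card_petersen_verts)
  then show "(MIN k\<in>{1..card ?P}. enat k + petersen.rad k) = 3"
    by (simp add: numeral_eq_enat)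

  have "petersen.th_c = enat 4"
    unfolding petersen.th_c_def
  proof (rule Min_enat_add_eqI[of 3])
    show "enat 3 + petersen.capt 3 \<le> enat 4"
      using add_left_mono[OF three_cops(1), of "enat 3"] by (simp add: one_enat_def eval_nat_numeral)
    \<comment> \<open>For the value 4 the size 3 must be bounded below too: three cops cannot occupy
      all ten vertices at the start, so they need at least one round.\<close>
    have three: "1 \<le> petersen.capt 3"
      by (rule petersen.one_le_capt) (simp add: card_petersen_verts)
    show "enat 4 \<le> enat j + petersen.capt j" if "1 \<le> j" "j < 4" for j
    proof -
      have "j = 1 \<or> j = 2 \<or> j = 3" using that by linarith
      then show ?thesis
        using add_left_mono[OF one_cop(1), of "enat 1"] add_left_mono[OF two_cops(1), of "enat 2"]
          add_left_mono[OF three, of "enat 3"]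
        by (auto simp: numeral_eq_enat one_enat_def eval_nat_numeral)
    qed
  qed (simp add: card_petersen_verts)
  then show "petersen.th_c = 4" by (simp add: numeral_eq_enat)

  have "petersen.th_d = enat 3"
    unfolding petersen.th_d_def
  proof (rule Min_enat_add_eqI[of 3])
    \<comment> \<open>Three dominating cops allow no damage, so here the sum is 3 + 0, and only one
      or two cops remain to be excluded.\<close>
    show "enat 3 + petersen.dmg 3 \<le> enat 3"
      by (simp add: three_cops(2))
    show "enat 3 \<le> enat j + petersen.dmg j" if "1 \<le> j" "j < 3" for j
      using k12[OF that] add_left_mono[OF one_cop(2), of "enat 1"]
        add_left_mono[OF two_cops(2), of "enat 2"]
      by (auto simp: numeral_eq_enat one_enat_def eval_nat_numeral)
  qed (simp add: card_petersen_verts)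
  then show "petersen.th_d = 3" by (simp add: numeral_eq_enat)
qed

end
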